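(* Let the system (L) be jacobian and let $\zeta\in\{1,\dots,m\}$ be such that $A_\zeta$ has the smallest number of elementary divisors among $A_1,\dots,A_m$. For $l=1,\dots,r$, let $\nu^{0l}$ be a common eigenvector of the matrices $A_j$ corresponding to the eigenvalues $\lambda_l^j$, $j=1,\dots,m$, respectively, and let $\nu^{\eta l}$, $\eta=1,\dots,s_l-1$, be generalized eigenvectors (of orders $\eta$) of the matrix $A_\zeta$ corresponding to the eigenvalue $\lambda_l^\zeta$ with elementary divisor of multiplicity $s_l$ ($s_l\ge2$), where $\sum_{l=1}^rs_l\ge m+1$. Let $\Psi^\zeta_{\eta l}$, $\eta=1,\dots,s_l-1$, be the functions determined by $$\nu^{\eta l}\gamma=\sum_{\delta=1}^{\eta}\binom{\eta-1}{\delta-1}\Psi^\zeta_{\delta l}(z)\,\nu^{\eta-\delta,l}\gamma,\quad \eta=1,\dots,s_l-1,$$ on a domain contained in $\{z:\nu^{0l}\gamma\ne0\}$, and suppose that the equation $\mathfrak L_\zeta(z)w=0$ does not have the first integrals $z\mapsto\mathfrak L_j\Psi^\zeta_{\eta l}(z)$, $j=1,\dots,m$, $j\ne\zeta$, $\eta=1,\dots,s_l-1$, $l=1,\dots,r$. Then the system (L) has the $\mathbb R$-differentiable first integral $$F\colon z\mapsto\prod_{\xi=1}^{\alpha}\bigl(\nu^{0\xi}\gamma\bigr)^{h_{0\xi}}\exp\sum_{q=1}^{\varepsilon_\xi}h_{q\xi}\Psi^\zeta_{q\xi}(z)\quad\text{for all }z\in\Omega,\qquad\Omega\subset\mathrm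 D(F),$$ where $\sum_{\xi=1}^\alpha\varepsilon_\xi=m-\alpha+1$, $\varepsilon_\xi\le s_\xi-1$, $\xi=1,\dots,\alpha$, $\alpha\le r$, and $h_{q\xi}$, $q=0,\dots,\varepsilon_\xi$, $\xi=1,\dots,\alpha$, is a nontrivial solution to the linear homogeneous system $$\sum_{\xi=1}^\alpha\Bigl(\lambda_\xi^j h_{0\xi}+\sum_{q=1}^{\varepsilon_\xi}\mu_{q\xi}^{j\zeta}h_{q\xi}\Bigr)=0,\quad j=1,\dots,m,$$ with $\mu_{q\xi}^{j\zeta}$ the constant value of $\mathfrak L_j\Psi^\zeta_{q\xi}(z)$.
   Context: System (L) is the linear homogeneous system of first-order partial differential equations $$\mathfrak L_j(z)w=0,\ j=1,\dots,m,\qquad \mathfrak L_j(z)=\sum_{\xi=1}^n\bigl(a_{j\xi}(z)\partial_{z_\xi}+a_{j,n+\xi}(z)\partial_{\overline z_\xi}\bigr),\ z\in\mathbb C^n,\tag{L}$$ with $\mathbb R$-linear coefficients $a_{jk}(z)=\sum_{\tau=1}^n(a_{jk\tau}z_\tau+a_{jk,n+\tau}\overline z_\tau)$, $a_{jkl}\in\mathbb C$, $k,l=1,\dots,2n$, $j=1,\dots,m$; $\partial_{z_\xi},\partial_{\overline z_\xi}$ are Wirtinger derivatives. The system is jacobian if all Poisson brackets (commutators) vanish: $[\mathfrak L_j(z),\mathfrak L_\zeta(z)]=0$ for all $z\in\mathbb C^n$, $j,\zeta=1,\dots,m$ (equivalently $A_jA_\zeta=A_\zeta A_j$). $A_j$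 is the $2n\times2n$ matrix whose entry in row $l$ and column $k$ is $a_{jkl}$, so that for $b=(b_1,\dots,b_{2n})$ the function $p(z)=\sum_{\xi=1}^n(b_\xi z_\xi+b_{n+\xi}\overline z_\xi)$ satisfies $\mathfrak L_jp=\lambda p$ if and only if $(A_j-\lambda E)b=0$. For $\nu\in\mathbb C^{2n}$, $\nu\gamma=\sum_{\xi=1}^n(\nu_\xi z_\xi+\nu_{n+\xi}\overline z_\xi)$, where $\gamma=(z_1,\dots,z_n,\overline z_1,\dots,\overline z_n)^T$. Generalized eigenvectors: let $\nu^{0l}$ be an eigenvector of $A_\zeta$ for the eigenvalue $\lambda_l^\zeta$ with elementary divisor of multiplicity $s_l$. A nonzero vector $\nu^{\eta l}\in\mathbb C^{2n}$ is a generalized eigenvector of order $\eta$ for $\lambda_l^\zeta$ if $(A_\zeta-\lambda_l^\zeta E)\nu^{\eta l}=\eta\,\nu^{\eta-1,l}$, $\eta=1,\dots,s_l-1$, where $E$ is the identity matrix. An $\mathbb R$-differentiable function $F$ on a domain $\Omega\subset\mathbb C^n$ (differentiable as a function of real and imaginary parts) is a first integral of (L) if $\mathfrak L_jF=0$ on $\Omega$, $j=1,\dots,m$ (and a first integral of $\mathfrak L_\zeta w=0$ if $\mathfrak L_\zeta F=0$). The hypothesis that $\mathfrak L_\zeta w=0$ does not have the first integrals $\mathfrak L_j\Psi^\zeta_{\eta l}$ means that none of these functions is a non-constant first integral of that equation; under the stated hypotheses each $\mathfrak L_j\Psi^\zeta_{\eta l}$ is identically constant ($j\ne\zeta$), while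 $\mathfrak L_\zeta\Psi^\zeta_{1l}=1$ and $\mathfrak L_\zeta\Psi^\zeta_{\eta l}=0$ for $\eta\ge2$, and these constants are the $\mu^{j\zeta}_{\eta l}$, $j=1,\dots,m$. $\mathrm D(F)$ is the domain of definition of $F$ (with branches of the powers chosen), and $\Omega$ is a domain contained in it. *)

theory Defs
  imports
    "HOL-Analysis.Analysis"
    "HOL-Computational_Algebra.Polynomial_Factorial"
    "HOL-Computational_Algebra.Field_as_Ring"
begin

section \<open>Operators with linear coefficients\<close>

text \<open>
  The index set {1, ..., 2n} is the type 'n + 'n with n = CARD('n): Inl \<xi> stands for \<xi>
  (the variable z_\<xi>) and Inr \<xi> stands for n + \<xi> (its conjugate).
\<close>

definition coords :: "complex ^ 'n \<Rightarrow> complex ^ ('n + 'n)" where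
  "coords z = (\<chi> k. case k of Inl \<xi> \<Rightarrow> z $ \<xi> | Inr \<xi> \<Rightarrow> cnj (z $ \<xi>))"

definition linear_form :: "complex ^ ('n + 'n) \<Rightarrow> complex ^ 'n \<Rightarrow> complex" where
  "linear_form \<nu> z = (\<Sum>k\<in>UNIV. \<nu> $ k * coords z $ k)"

text \<open>
  The Wirtinger derivatives (\<partial>_x - i \<partial>_y) / 2 and (\<partial>_x + i \<partial>_y) / 2.
  The Frechet derivative is the real one, since has_derivative refers to real-linear maps.
\<close>

definition wirtinger :: "'n + 'n \<Rightarrow> (complex ^ 'n \<Rightarrow> complex) \<Rightarrow> complex ^ 'n \<Rightarrow> complex" where
  "wirtinger k w z =
     (case k of
        Inl \<xi> \<Rightarrow> (frechet_derivative w (at z) (axis \<xi> 1)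
                   - \<i> * frechet_derivative w (at z) (axis \<xi> \<i>)) / 2
      | Inr \<xi> \<Rightarrow> (frechet_derivative w (at z) (axis \<xi> 1)
                   + \<i> * frechet_derivative w (at z) (axis \<xi> \<i>)) / 2)"

text \<open>The coefficient array c k l of one operator determines both the operator and its matrix.\<close>

definition lin_op ::
  "('n + 'n \<Rightarrow> 'n + 'n \<Rightarrow> complex) \<Rightarrow> (complex ^ 'n \<Rightarrow> complex) \<Rightarrow> complex ^ 'n \<Rightarrow> complex" where
  "lin_op c w z = (\<Sum>k\<in>UNIV. (\<Sum>l\<in>UNIV. c k l * coords z $ l) * wirtinger k w z)"

definition op_matrix ::
  "('n::finite + 'n \<Rightarrow> 'n + 'n \<Rightarrow> complex) \<Rightarrow> complex ^ ('n + 'n) ^ ('n + 'n)" where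
  "op_matrix c = (\<chi> l k. c k l)"

text \<open>Global functions of class C^r, as functions of the real and imaginary parts.\<close>

primrec C_class :: "nat \<Rightarrow> (complex ^ 'n \<Rightarrow> complex) \<Rightarrow> bool" where
  "C_class 0 w \<longleftrightarrow> continuous_on UNIV w"
| "C_class (Suc r) w \<longleftrightarrow> w differentiable_on UNIV \<and> (\<forall>k. C_class r (wirtinger k w))"

text \<open>
  The bracket of first-order operators is their commutator; it is the zero operator if it
  annihilates every C^2 function on the whole space.
\<close>

definition jacobian_system :: "nat \<Rightarrow> (nat \<Rightarrow> 'n::finite + 'n \<Rightarrow> 'n + 'n \<Rightarrow> complex) \<Rightarrow> bool" where
  "jacobian_system m a \<longleftrightarrow>
     (\<forall>i\<in>{1..m}. \<forall>j\<in>{1..m}. \<forall>w. C_class 2 w \<longrightarrow>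
        (\<forall>z. lin_op (a i) (lin_op (a j) w) z - lin_op (a j) (lin_op (a i) w) z = 0))"

definition is_domain :: "'a::topological_space set \<Rightarrow> bool" where
  "is_domain S \<longleftrightarrow> open S \<and> connected S \<and> S \<noteq> {}"

text \<open>A first integral of the system whose operators have the coefficient arrays in C.\<close>

definition first_integral ::
  "('n + 'n \<Rightarrow> 'n + 'n \<Rightarrow> complex) set \<Rightarrow> (complex ^ 'n) set \<Rightarrow> (complex ^ 'n \<Rightarrow> complex) \<Rightarrow> bool"
where
  "first_integral C \<Omega> F \<longleftrightarrow> F differentiable_on \<Omega> \<and> (\<forall>c\<in>C. \<forall>z\<in>\<Omega>. lin_op c F z = 0)"

section \<open>Elementary divisors\<close>

definition char_matrix :: "complex ^ 'd ^ 'd \<Rightarrow> complex poly ^ 'd ^ 'd" where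
  "char_matrix A = (\<chi> i j. (if i = j then [:0, 1:] else 0) - [:A $ i $ j:])"

text \<open>The k-rowed minor (Leibniz formula) with rows f 0, ..., f (k-1) and columns g 0, ..., g (k-1).\<close>

definition minor :: "nat \<Rightarrow> complex poly ^ 'd ^ 'd \<Rightarrow> (nat \<Rightarrow> 'd) \<Rightarrow> (nat \<Rightarrow> 'd) \<Rightarrow> complex poly" where
  "minor k M f g = (\<Sum>\<pi> | \<pi> permutes {..<k}. of_int (sign \<pi>) * (\<Prod>i<k. M $ f i $ g (\<pi> i)))"

definition determinantal_divisor :: "complex ^ 'd ^ 'd \<Rightarrow> nat \<Rightarrow> complex poly" where
  "determinantal_divisor A k =
     Gcd {minor k (char_matrix A) f g | f g. inj_on f {..<k} \<and> inj_on g {..<k}}"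

definition invariant_factor :: "complex ^ 'd ^ 'd \<Rightarrow> nat \<Rightarrow> complex poly" where
  "invariant_factor A k = determinantal_divisor A k div determinantal_divisor A (k - 1)"

text \<open>
  The multiset of all powers (x - \<rho>)^s, s > 0, occurring as exact powers in the invariant
  factors of x E - A. The invariant factors are nonzero, so the index set below is finite.
\<close>

definition elementary_divisors :: "complex ^ 'd ^ 'd \<Rightarrow> complex poly multiset" where
  "elementary_divisors A =
     image_mset (\<lambda>(k, \<rho>). [:- \<rho>, 1:] ^ order \<rho> (invariant_factor A k))
       (mset_set {(k, \<rho>). k \<in> {1..CARD('d)} \<and> poly (invariant_factor A k) \<rho> = 0})"

section \<open>Branches of powers\<close>

text \<open>
  The values of the multivalued power w^c. The second set only matters for w = 0: a power
  with exponent k = 0, 1, 2, ... is also defined there.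
\<close>

definition power_values :: "complex \<Rightarrow> complex \<Rightarrow> complex set" where
  "power_values w c = {exp (c * t) | t. exp t = w} \<union> {w ^ k | k. c = of_nat k}"

text \<open>p is a branch of u^c on \<Omega>; in particular this power is defined everywhere on \<Omega>.\<close>

definition power_branch ::
  "'a::topological_space set \<Rightarrow> ('a \<Rightarrow> complex) \<Rightarrow> complex \<Rightarrow> ('a \<Rightarrow> complex) \<Rightarrow> bool" where
  "power_branch \<Omega> u c p \<longleftrightarrow> continuous_on \<Omega> p \<and> (\<forall>z\<in>\<Omega>. p z \<in> power_values (u z) c)"

section \<open>The exponents\<close>

definition admissible :: "nat \<Rightarrow> nat \<Rightarrow> (nat \<Rightarrow> nat) \<Rightarrow> nat \<Rightarrow> (nat \<Rightarrow> nat) \<Rightarrow> bool" where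
  "admissible m r s \<alpha> \<epsilon> \<longleftrightarrow>
     \<alpha> \<le> r \<and> (\<forall>\<xi>\<in>{1..\<alpha>}. \<epsilon> \<xi> \<le> s \<xi> - 1) \<and> (\<Sum>\<xi>=1..\<alpha>. int (\<epsilon> \<xi>)) = int m - int \<alpha> + 1"

definition nontrivial_solution ::
  "nat \<Rightarrow> (nat \<Rightarrow> nat \<Rightarrow> complex) \<Rightarrow> (nat \<Rightarrow> nat \<Rightarrow> nat \<Rightarrow> complex) \<Rightarrow> nat \<Rightarrow> (nat \<Rightarrow> nat)
     \<Rightarrow> (nat \<Rightarrow> nat \<Rightarrow> complex) \<Rightarrow> bool" where
  "nontrivial_solution m lam \<mu> \<alpha> \<epsilon> h \<longleftrightarrow>
     (\<exists>\<xi>\<in>{1..\<alpha>}. \<exists>q\<in>{0..\<epsilon> \<xi>}. h q \<xi> \<noteq> 0) \<and>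
     (\<forall>j\<in>{1..m}. (\<Sum>\<xi>=1..\<alpha>. lam j \<xi> * h 0 \<xi> + (\<Sum>q=1..\<epsilon> \<xi>. \<mu> j q \<xi> * h q \<xi>)) = 0)"

end

theory Submission
  imports Defs
begin

text \<open>
  Write L_j for the operators and u_\<eta> for the linear forms with coefficient vectors \<nu> \<eta> l, for a
  fixed l. The product F is a product of eigenfunctions of every L_j, and the eigenvalue of a product
  is the sum of the eigenvalues of the factors. The linear system imposed on the exponents h says that
  this sum vanishes for each j, so L_j F = 0.

  The factors are eigenfunctions for two reasons. First, L_j acts on linear forms by its matrix
  (\<open>lin_op_linear_form\<close>), so u_0 is an eigenfunction for \<lambda>_l^j; a branch of a power of u_0 then is one
  for the corresponding multiple of \<lambda>_l^j (\<open>lin_op_power_branch\<close>). Since a branch is only given as a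
  continuous selection of values, its differentiability has to be derived, by comparison with
  the exponential of a local logarithm (\<open>power_branch_local\<close>).

  Second, L_j maps every function \<Psi> \<eta> l to a constant, so that the exponential of a linear
  combination of these functions is an eigenfunction. For j = \<zeta> the constants are 1 for \<eta> = 1 and 0
  for \<eta> \<ge> 2, by induction along the Jordan chain (\<open>lin_op_Psi\<close>). For j \<noteq> \<zeta> the operators L_\<zeta> and
  L_j commute on \<Psi> \<eta> l: they do so on linear forms because the system is jacobian, and \<Psi> \<eta> l is a
  polynomial in linear forms and the reciprocal of u_0 (\<open>commuting_on_Psi\<close>). Hence L_\<zeta> annihilates
  L_j \<Psi> \<eta> l, which therefore is a first integral of L_\<zeta>, and by hypothesis a constant one.

  An admissible \<epsilon> amounts to m + 1 unknowns h for m homogeneous equations, so a nontrivial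
  solution exists (\<open>underdetermined_system_has_nontrivial_solution\<close>); an admissible \<epsilon> exists
  because the numbers s l add up to at least m + 1 (\<open>admissible_exists\<close>).
\<close>

section \<open>Linear operators as derivations\<close>

text \<open>
  An operator acts on w through the real derivative D of w alone, and complex-linearly in D.
  Sums, products and compositions with holomorphic functions have explicit derivatives, so
  making this dependence on D explicit turns all rules of differentiation into linearity.
\<close>

definition lin_op_at ::
  "('n::finite + 'n \<Rightarrow> 'n + 'n \<Rightarrow> complex) \<Rightarrow> complex ^ 'n \<Rightarrow> (complex ^ 'n \<Rightarrow> complex) \<Rightarrow> complex" where
  "lin_op_at c z D = (\<Sum>k\<in>UNIV. (\<Sum>l\<in>UNIV. c k l * coords z $ l) *
     (case k of Inl \<xi> \<Rightarrow> (D (axis \<xi> 1) - \<i> * D (axis \<xi> \<i>)) / 2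
      | Inr \<xi> \<Rightarrow> (D (axis \<xi> 1) + \<i> * D (axis \<xi> \<i>)) / 2))"

lemma lin_op_eq_lin_op_at:
  assumes "(f has_derivative D) (at z)"
  shows "lin_op c f z = lin_op_at c z D"
  unfolding lin_op_def lin_op_at_def wirtinger_def frechet_derivative_at[OF assms, symmetric] ..

lemma lin_op_at_linear:
  "lin_op_at c z (\<lambda>h. x * D h + y * E h) = x * lin_op_at c z D + y * lin_op_at c z E"
  unfolding lin_op_at_def sum_distrib_left sum.distrib[symmetric]
  by (rule sum.cong) (auto simp: algebra_simps add_divide_distrib diff_divide_distrib split: sum.split)

lemma lin_op_at_scale: "lin_op_at c z (\<lambda>h. x * D h) = x * lin_op_at c z D"
  using lin_op_at_linear[of c z x D 0 D] by simp

lemma lin_op_const [simp]: "lin_op c (\<lambda>z. k) z = 0"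
proof -
  have "((\<lambda>z. k) has_derivative (\<lambda>h. 0 * 0)) (at z)" by simp
  from lin_op_eq_lin_op_at[OF this, of c] show ?thesis
    by (simp add: lin_op_at_def sum.neutral split: sum.split)
qed

lemma lin_op_add:
  assumes "f differentiable (at z)" "g differentiable (at z)"
  shows "lin_op c (\<lambda>z. f z + g z) z = lin_op c f z + lin_op c g z"
proof -
  obtain D E where D: "(f has_derivative D) (at z)" and E: "(g has_derivative E) (at z)"
    using assms unfolding differentiable_def by blast
  show ?thesis
    using lin_op_eq_lin_op_at[OF has_derivative_add[OF D E], of c]
      lin_op_at_linear[of c z 1 D 1 E] lin_op_eq_lin_op_at[OF D] lin_op_eq_lin_op_at[OF E]
    by simp
qed

lemma lin_op_mult:
  assumes "f differentiable (at z)" "g differentiable (at z)"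
  shows "lin_op c (\<lambda>z. f z * g z) z = lin_op c f z * g z + f z * lin_op c g z"
proof -
  obtain D E where D: "(f has_derivative D) (at z)" and E: "(g has_derivative E) (at z)"
    using assms unfolding differentiable_def by blast
  have "((\<lambda>z. f z * g z) has_derivative (\<lambda>h. f z * E h + g z * D h)) (at z)"
    using has_derivative_mult[OF D E] by (simp add: mult.commute)
  from lin_op_eq_lin_op_at[OF this, of c] show ?thesis
    using lin_op_eq_lin_op_at[OF D] lin_op_eq_lin_op_at[OF E]
    by (simp add: lin_op_at_linear)
qed

lemma lin_op_cmult:
  assumes "f differentiable (at z)"
  shows "lin_op c (\<lambda>z. k * f z) z = k * lin_op c f z"
  using lin_op_mult[of "\<lambda>z. k" z f c] assms by simp

lemma lin_op_sum:
  assumes "finite I" "\<And>i. i \<in> I \<Longrightarrow> f i differentiable (at z)"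
  shows "lin_op c (\<lambda>z. \<Sum>i\<in>I. f i z) z = (\<Sum>i\<in>I. lin_op c (f i) z)"
  using assms
proof (induction I)
  case (insert i I)
  then show ?case
    using lin_op_add[of "f i" z "\<lambda>z. \<Sum>i\<in>I. f i z" c] by (simp add: differentiable_sum)
qed simp

text \<open>
  The outer function is complex differentiable, so its derivative is multiplication by the
  complex number d, and an operator is complex-linear in the derivative of its argument.
\<close>

lemma
  assumes f: "f differentiable (at z)" and phi: "(\<phi> has_field_derivative d) (at (f z))"
  shows differentiable_chain: "(\<lambda>z. \<phi> (f z)) differentiable (at z)"
    and lin_op_chain: "lin_op c (\<lambda>z. \<phi> (f z)) z = d * lin_op c f z"
proof -
  obtain D where D: "(f has_derivative D) (at z)"
    using f unfolding differentiable_def by blast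
  have *: "((\<lambda>z. \<phi> (f z)) has_derivative (\<lambda>h. d * D h)) (at z)"
    using has_derivative_compose[OF D phi[unfolded has_field_derivative_def]] by simp
  then show "(\<lambda>z. \<phi> (f z)) differentiable (at z)"
    unfolding differentiable_def by blast
  show "lin_op c (\<lambda>z. \<phi> (f z)) z = d * lin_op c f z"
    using lin_op_eq_lin_op_at[OF *, of c] lin_op_eq_lin_op_at[OF D, of c]
    by (simp add: lin_op_at_scale)
qed

lemma
  assumes S: "open S" "z \<in> S" and eq: "\<And>y. y \<in> S \<Longrightarrow> f y = g y"
    and g: "g differentiable (at z)"
  shows differentiable_cong_open: "f differentiable (at z)"
    and lin_op_cong_open: "lin_op c f z = lin_op c g z"
proof -
  obtain D where D: "(g has_derivative D) (at z)"
    using g unfolding differentiable_def by blast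
  have *: "(f has_derivative D) (at z)"
    by (rule has_derivative_transform_within_open[OF D S]) (simp add: eq)
  then show "f differentiable (at z)" unfolding differentiable_def by blast
  show "lin_op c f z = lin_op c g z"
    using lin_op_eq_lin_op_at[OF *, of c] lin_op_eq_lin_op_at[OF D, of c] by simp
qed

section \<open>Linear forms\<close>

text \<open>
  A linear form is linear in z and its conjugate, hence only real-linear in z; this makes it its
  own real derivative.
\<close>

lemma has_derivative_linear_form:
  fixes \<nu> :: "complex ^ ('n::finite + 'n)"
  shows "(linear_form \<nu> has_derivative linear_form \<nu>) (at z)"
proof (rule bounded_linear_imp_has_derivative)
  have "linear (linear_form \<nu>)"
    by (rule linearI)
      (auto simp: linear_form_def coords_def algebra_simps scaleR_sum_right
        intro!: sum.cong split: sum.split simp flip: sum.distrib)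
  then show "bounded_linear (linear_form \<nu>)"
    by (simp add: linear_conv_bounded_linear)
qed

lemma linear_form_axis:
  "linear_form \<nu> (axis \<xi> x) = \<nu> $ Inl \<xi> * x + \<nu> $ Inr \<xi> * cnj x"
proof -
  have *: "(\<Sum>i\<in>UNIV. f i * g (axis \<xi> x $ i)) = f \<xi> * g x" if "g 0 = 0"
    for f :: "'a \<Rightarrow> complex" and g :: "complex \<Rightarrow> complex"
  proof -
    have "(\<Sum>i\<in>UNIV. f i * g (axis \<xi> x $ i)) = (\<Sum>i\<in>UNIV. if i = \<xi> then f \<xi> * g x else 0)"
      by (rule sum.cong) (auto simp: axis_def that)
    then show ?thesis by simp
  qed
  show ?thesis
    unfolding linear_form_def UNIV_Plus_UNIV[symmetric]
    by (subst sum.Plus)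
      (simp_all add: coords_def *[of "\<lambda>y. y", simplified] *[of cnj, simplified])
qed

lemma linear_form_differentiable: "linear_form \<nu> differentiable (at z)"
  using has_derivative_linear_form unfolding differentiable_def by blast

lemma wirtinger_linear_form: "wirtinger k (linear_form \<nu>) = (\<lambda>z. \<nu> $ k)"
  by (rule ext)
    (auto simp: wirtinger_def frechet_derivative_at[OF has_derivative_linear_form, symmetric]
      linear_form_axis algebra_simps split: sum.split)

text \<open>
  On linear forms the operator acts as its matrix on coefficient vectors. Eigenvectors and Jordan
  chains thereby become differential relations between linear forms.
\<close>

lemma lin_op_linear_form: "lin_op c (linear_form \<nu>) = linear_form (op_matrix c *v \<nu>)"
proof
  fix z
  have "lin_op c (linear_form \<nu>) z = (\<Sum>k\<in>UNIV. \<Sum>l\<in>UNIV. c k l * coords z $ l * \<nu> $ k)"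
    by (simp add: lin_op_def wirtinger_linear_form sum_distrib_right)
  also have "\<dots> = (\<Sum>l\<in>UNIV. \<Sum>k\<in>UNIV. c k l * coords z $ l * \<nu> $ k)"
    by (rule sum.swap)
  also have "\<dots> = linear_form (op_matrix c *v \<nu>) z"
    by (simp add: linear_form_def matrix_vector_mult_def op_matrix_def sum_distrib_right
        sum_distrib_left mult_ac)
  finally show "lin_op c (linear_form \<nu>) z = linear_form (op_matrix c *v \<nu>) z" .
qed

lemma linear_form_add: "linear_form (v + w) z = linear_form v z + linear_form w z"
  by (simp add: linear_form_def algebra_simps sum.distrib)

lemma linear_form_scale: "linear_form (x *s v) z = x * linear_form v z"
  by (simp add: linear_form_def sum_distrib_left mult_ac)

lemma wirtinger_const: "wirtinger k (\<lambda>z. x) = (\<lambda>z. 0)"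
  by (rule ext)
    (auto simp: wirtinger_def frechet_derivative_at[OF has_derivative_const, symmetric]
      split: sum.split)

lemma C_class_linear_form: "C_class 2 (linear_form \<nu>)"
  by (auto simp: numeral_2_eq_2 wirtinger_linear_form wirtinger_const differentiable_on_def
      linear_form_differentiable differentiable_at_withinI)

lemma mat_mult_vector: "mat x *v v = x *s (v :: 'a::comm_semiring_1 ^ 'n)"
proof -
  have "(\<Sum>j\<in>UNIV. (if i = j then x else 0) * v $ j) = x * v $ i" for i
  proof -
    have "(\<Sum>j\<in>UNIV. (if i = j then x else 0) * v $ j) = (\<Sum>j\<in>UNIV. if i = j then x * v $ j else 0)"
      by (rule sum.cong) auto
    then show ?thesis by simp
  qed
  then show ?thesis by (simp add: vec_eq_iff matrix_vector_mult_def mat_def)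
qed

section \<open>Commuting operators\<close>

text \<open>
  The bracket of two operators vanishes on global functions, whereas the functions
  \<^term>\<open>\<Psi>\<close> live on a domain only. They are obtained from linear forms by algebraic
  operations, so it suffices that sums and products preserve commutation.
  The differentiability of the first derivatives is carried along, because the rules for sums
  and products are applied to them in turn.
\<close>

definition commuting_on ::
  "('n::finite + 'n \<Rightarrow> 'n + 'n \<Rightarrow> complex) \<Rightarrow> ('n + 'n \<Rightarrow> 'n + 'n \<Rightarrow> complex) \<Rightarrow>
    (complex ^ 'n) set \<Rightarrow> (complex ^ 'n \<Rightarrow> complex) \<Rightarrow> bool" where
  "commuting_on c d S f \<longleftrightarrow> (\<forall>z\<in>S. f differentiable (at z) \<and>
     lin_op c f differentiable (at z) \<and> lin_op d f differentiable (at z) \<and>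
     lin_op c (lin_op d f) z = lin_op d (lin_op c f) z)"

lemma commuting_on_const: "commuting_on c d S (\<lambda>z. k)"
proof -
  have "lin_op c (\<lambda>z. k) = (\<lambda>z. 0)" for c :: "'a + 'a \<Rightarrow> 'a + 'a \<Rightarrow> complex" by auto
  then show ?thesis by (simp add: commuting_on_def)
qed

lemma commuting_on_cong:
  assumes S: "open S" and eq: "\<And>z. z \<in> S \<Longrightarrow> f z = g z" and g: "commuting_on c d S g"
  shows "commuting_on c d S f"
proof -
  have L: "lin_op e f z = lin_op e g z" if "z \<in> S" for e z
    using lin_op_cong_open[OF S that eq] g that by (auto simp: commuting_on_def)
  show ?thesis
    unfolding commuting_on_def
  proof (intro ballI conjI)
    fix z assume z: "z \<in> S"
    note g = g[unfolded commuting_on_def, rule_format, OF z]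
    show "f differentiable (at z)"
      by (rule differentiable_cong_open[OF S z eq]) (use g in auto)
    show "lin_op c f differentiable (at z)"
      using differentiable_cong_open[OF S z, of "lin_op c f" "lin_op c g"] L g by blast
    show "lin_op d f differentiable (at z)"
      using differentiable_cong_open[OF S z, of "lin_op d f" "lin_op d g"] L g by blast
    have "lin_op c (lin_op d f) z = lin_op c (lin_op d g) z"
      using lin_op_cong_open[OF S z, of "lin_op d f" "lin_op d g"] L g by blast
    moreover have "lin_op d (lin_op c f) z = lin_op d (lin_op c g) z"
      using lin_op_cong_open[OF S z, of "lin_op c f" "lin_op c g"] L g by blast
    ultimately show "lin_op c (lin_op d f) z = lin_op d (lin_op c f) z" using g by simp
  qed
qed

lemma commuting_on_add:
  assumes S: "open S" and f: "commuting_on c d S f" and g: "commuting_on c d S g"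
  shows "commuting_on c d S (\<lambda>z. f z + g z)"
proof -
  have L: "lin_op e (\<lambda>z. f z + g z) z = lin_op e f z + lin_op e g z" if "z \<in> S" for e z
    by (intro lin_op_add) (use f g that in \<open>auto simp: commuting_on_def\<close>)
  show ?thesis
    unfolding commuting_on_def
  proof (intro ballI conjI)
    fix z assume z: "z \<in> S"
    note f = f[unfolded commuting_on_def, rule_format, OF z]
    note g = g[unfolded commuting_on_def, rule_format, OF z]
    have D: "(\<lambda>z. lin_op c f z + lin_op c g z) differentiable (at z)"
      "(\<lambda>z. lin_op d f z + lin_op d g z) differentiable (at z)"
      using f g by (auto intro: differentiable_add)
    show "(\<lambda>z. f z + g z) differentiable (at z)"
      using f g by (auto intro: differentiable_add)
    show "lin_op c (\<lambda>z. f z + g z) differentiable (at z)"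
      "lin_op d (\<lambda>z. f z + g z) differentiable (at z)"
      using differentiable_cong_open[OF S z L D(1)] differentiable_cong_open[OF S z L D(2)]
      by blast+
    show "lin_op c (lin_op d (\<lambda>z. f z + g z)) z = lin_op d (lin_op c (\<lambda>z. f z + g z)) z"
      using lin_op_cong_open[OF S z L D(1)] lin_op_cong_open[OF S z L D(2)] f g
      by (simp add: lin_op_add)
  qed
qed

text \<open>
  Applying both operators to a product leaves the mixed terms
  \<^term>\<open>lin_op c f z * lin_op d g z + lin_op d f z * lin_op c g z\<close>, which are symmetric in
  the two operators.
\<close>

lemma commuting_on_mult:
  assumes S: "open S" and f: "commuting_on c d S f" and g: "commuting_on c d S g"
  shows "commuting_on c d S (\<lambda>z. f z * g z)"
proof -
  have L: "lin_op e (\<lambda>z. f z * g z) z = lin_op e f z * g z + f z * lin_op e g z"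
    if "z \<in> S" for e z
    by (intro lin_op_mult) (use f g that in \<open>auto simp: commuting_on_def\<close>)
  show ?thesis
    unfolding commuting_on_def
  proof (intro ballI conjI)
    fix z assume z: "z \<in> S"
    note f = f[unfolded commuting_on_def, rule_format, OF z]
    note g = g[unfolded commuting_on_def, rule_format, OF z]
    have D: "(\<lambda>z. lin_op c f z * g z + f z * lin_op c g z) differentiable (at z)"
      "(\<lambda>z. lin_op d f z * g z + f z * lin_op d g z) differentiable (at z)"
      using f g by (auto intro!: differentiable_add differentiable_mult)
    show "(\<lambda>z. f z * g z) differentiable (at z)"
      using f g by (auto intro: differentiable_mult)
    show "lin_op c (\<lambda>z. f z * g z) differentiable (at z)"
      "lin_op d (\<lambda>z. f z * g z) differentiable (at z)"
      using differentiable_cong_open[OF S z L D(1)] differentiable_cong_open[OF S z L D(2)]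
      by blast+
    show "lin_op c (lin_op d (\<lambda>z. f z * g z)) z = lin_op d (lin_op c (\<lambda>z. f z * g z)) z"
      using lin_op_cong_open[OF S z L D(1), of d] lin_op_cong_open[OF S z L D(2), of c] f g
      by (simp add: lin_op_add lin_op_mult differentiable_mult algebra_simps)
  qed
qed

lemma commuting_on_sum:
  assumes "open S" "finite I" "\<And>i. i \<in> I \<Longrightarrow> commuting_on c d S (f i)"
  shows "commuting_on c d S (\<lambda>z. \<Sum>i\<in>I. f i z)"
  using assms(2,3)
proof (induction I)
  case (insert i I)
  then show ?case using commuting_on_add[OF assms(1), of c d "f i"] by simp
qed (simp add: commuting_on_const)

text \<open>
  Linear forms are smooth on the whole space, so the vanishing bracket applies to them directly.
\<close>

lemma commuting_on_linear_form:
  assumes "jacobian_system m a" "i \<in> {1..m}" "j \<in> {1..m}"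
  shows "commuting_on (a i) (a j) S (linear_form \<nu>)"
proof -
  have "lin_op (a i) (lin_op (a j) (linear_form \<nu>)) z = lin_op (a j) (lin_op (a i) (linear_form \<nu>)) z"
    for z
    using assms C_class_linear_form[of \<nu>] unfolding jacobian_system_def by auto
  then show ?thesis
    by (simp add: commuting_on_def linear_form_differentiable lin_op_linear_form)
qed

text \<open>
  The reciprocal of an eigenfunction is again an eigenfunction, for the opposite eigenvalue, and
  multiplications by constants commute.
\<close>

lemma commuting_on_inverse_eigenform:
  assumes S: "open S" "\<And>z. z \<in> S \<Longrightarrow> linear_form \<nu> z \<noteq> 0"
    and c: "op_matrix c *v \<nu> = x *s \<nu>" and d: "op_matrix d *v \<nu> = y *s \<nu>"
  shows "commuting_on c d S (\<lambda>z. inverse (linear_form \<nu> z))"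
proof -
  let ?f = "\<lambda>z. inverse (linear_form \<nu> z)"
  have df: "?f differentiable (at z)"
    and L: "op_matrix e *v \<nu> = t *s \<nu> \<Longrightarrow> lin_op e ?f z = - t * ?f z" if "z \<in> S" for e t z
  proof -
    have nz: "linear_form \<nu> z \<noteq> 0" using S that by blast
    note inv = DERIV_inverse[OF nz]
    show "?f differentiable (at z)"
      by (rule differentiable_chain[OF linear_form_differentiable inv])
    show "lin_op e ?f z = - t * ?f z" if "op_matrix e *v \<nu> = t *s \<nu>"
      using lin_op_chain[OF linear_form_differentiable inv, of e] nz that
      by (simp add: lin_op_linear_form linear_form_scale power2_eq_square)
  qed
  have dt: "(\<lambda>z. - t * ?f z) differentiable (at z)" if "z \<in> S" for t z
    using df[OF that] by (intro differentiable_mult) auto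
  show ?thesis
    unfolding commuting_on_def
  proof (intro ballI conjI)
    fix z assume z: "z \<in> S"
    show "?f differentiable (at z)" by (rule df[OF z])
    show "lin_op c ?f differentiable (at z)"
      by (rule differentiable_cong_open[OF S(1) z L[OF _ c] dt[OF z]])
    show "lin_op d ?f differentiable (at z)"
      by (rule differentiable_cong_open[OF S(1) z L[OF _ d] dt[OF z]])
    have "lin_op c (lin_op d ?f) z = y * (x * ?f z)"
      using lin_op_cong_open[OF S(1) z L[OF _ d] dt[OF z], of c] L[OF z c]
        lin_op_cmult[OF df[OF z], of c "- y"] by simp
    moreover have "lin_op d (lin_op c ?f) z = x * (y * ?f z)"
      using lin_op_cong_open[OF S(1) z L[OF _ c] dt[OF z], of d] L[OF z d]
        lin_op_cmult[OF df[OF z], of d "- x"] by simp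
    ultimately show "lin_op c (lin_op d ?f) z = lin_op d (lin_op c ?f) z" by simp
  qed
qed

section \<open>The functions attached to a Jordan chain\<close>

text \<open>
  The relation of order \<eta> contains \<^term>\<open>\<Psi> \<eta>\<close> only in its last summand, with the factor
  \<^term>\<open>u 0\<close>. Solving for it expresses \<^term>\<open>\<Psi> \<eta>\<close> through the functions of lower order,
  linear forms and the reciprocal of \<^term>\<open>u 0\<close>.
\<close>

lemma commuting_on_Psi:
  fixes u \<Psi> :: "nat \<Rightarrow> complex ^ 'n::finite \<Rightarrow> complex"
  assumes S: "open S" and nz: "\<And>z. z \<in> S \<Longrightarrow> u 0 z \<noteq> 0"
    and inv: "commuting_on c d S (\<lambda>z. inverse (u 0 z))"
    and u: "\<And>\<eta>. commuting_on c d S (u \<eta>)"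
    and Psi: "\<And>\<eta> z. \<eta> \<in> {1..N} \<Longrightarrow> z \<in> S \<Longrightarrow>
      u \<eta> z = (\<Sum>\<delta>=1..\<eta>. of_nat ((\<eta> - 1) choose (\<delta> - 1)) * \<Psi> \<delta> z * u (\<eta> - \<delta>) z)"
    and "\<eta> \<in> {1..N}"
  shows "commuting_on c d S (\<Psi> \<eta>)"
  using \<open>\<eta> \<in> {1..N}\<close>
proof (induction \<eta> rule: less_induct)
  case (less \<eta>)
  obtain n where n: "\<eta> = Suc n" using less.prems by (cases \<eta>) auto
  define R where "R = (\<lambda>z. u \<eta> z +
    (\<Sum>\<delta>=1..n. (- of_nat (n choose (\<delta> - 1)) * \<Psi> \<delta> z) * u (\<eta> - \<delta>) z))"
  have "commuting_on c d S (\<Psi> \<delta>)" if "\<delta> \<in> {1..n}" for \<delta>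
    using less that n by auto
  then have "commuting_on c d S R"
    unfolding R_def
    by (intro commuting_on_add[OF S] commuting_on_mult[OF S] commuting_on_sum[OF S] u
        commuting_on_const) auto
  then have *: "commuting_on c d S (\<lambda>z. R z * inverse (u 0 z))"
    by (intro commuting_on_mult[OF S] inv)
  have "\<Psi> \<eta> z = R z * inverse (u 0 z)" if z: "z \<in> S" for z
  proof -
    have "R z = \<Psi> \<eta> z * u 0 z"
      using Psi[OF less.prems z] by (simp add: R_def n sum_negf)
    then show ?thesis using nz[OF z] by simp
  qed
  then show ?case using commuting_on_cong[OF S _ *] by blast
qed

text \<open>
  Formally, the relations say that the exponential generating function of the \<^term>\<open>u \<eta> z\<close> in a
  variable t is \<open>u 0 z * exp (\<Sum>\<delta>. \<Psi> \<delta> z * t ^ \<delta> / fact \<delta>)\<close>. By the Jordan chain relation the operator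
  multiplies this function by x + t. It multiplies \<^term>\<open>u 0\<close> by x, so it maps the exponent
  to t. The proof compares coefficients: when the operator is applied to the relation of order
  \<eta>, the absorption identity for binomial coefficients reassembles the terms in which the operator
  lowers the order of a linear form into the relation of order \<eta> - 1. What is left is
  \<open>(\<Sum>\<delta>=1..\<eta>. ((\<eta> - 1) choose (\<delta> - 1)) * lin_op c (\<Psi> \<delta>) z * u (\<eta> - \<delta>) z) = u (\<eta> - 1) z\<close>.
\<close>

lemma lin_op_Psi:
  fixes u \<Psi> :: "nat \<Rightarrow> complex ^ 'n::finite \<Rightarrow> complex"
  assumes S: "open S" and nz: "\<And>z. z \<in> S \<Longrightarrow> u 0 z \<noteq> 0"
    and du: "\<And>\<eta> z. z \<in> S \<Longrightarrow> u \<eta> differentiable (at z)"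
    and dPsi: "\<And>\<eta> z. \<eta> \<in> {1..N} \<Longrightarrow> z \<in> S \<Longrightarrow> \<Psi> \<eta> differentiable (at z)"
    and Lu: "\<And>\<eta> z. \<eta> \<le> N \<Longrightarrow> z \<in> S \<Longrightarrow> lin_op c (u \<eta>) z = x * u \<eta> z + of_nat \<eta> * u (\<eta> - 1) z"
    and Psi: "\<And>\<eta> z. \<eta> \<in> {1..N} \<Longrightarrow> z \<in> S \<Longrightarrow>
      u \<eta> z = (\<Sum>\<delta>=1..\<eta>. of_nat ((\<eta> - 1) choose (\<delta> - 1)) * \<Psi> \<delta> z * u (\<eta> - \<delta>) z)"
    and "\<eta> \<in> {1..N}" and z: "z \<in> S"
  shows "lin_op c (\<Psi> \<eta>) z = (if \<eta> = 1 then 1 else 0)"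
  using \<open>\<eta> \<in> {1..N}\<close>
proof (induction \<eta> rule: less_induct)
  case (less \<eta>)
  obtain n where n: "\<eta> = Suc n" using less.prems by (cases \<eta>) auto
  define b where "b \<delta> = (of_nat (n choose (\<delta> - 1)) :: complex)" for \<delta>
  define L where "L = lin_op c"
  have mem: "\<delta> \<in> {1..N}" if "\<delta> \<in> {1..\<eta>}" for \<delta> using that less.prems by auto
  have Psi_\<eta>: "u \<eta> y = (\<Sum>\<delta>=1..\<eta>. b \<delta> * \<Psi> \<delta> y * u (\<eta> - \<delta>) y)" if "y \<in> S" for y
    using Psi[OF less.prems that] by (simp add: b_def n)
  have d: "(\<lambda>y. b \<delta> * \<Psi> \<delta> y * u (\<eta> - \<delta>) y) differentiable (at z)" if "\<delta> \<in> {1..\<eta>}" for \<delta>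
    using du[OF z] dPsi[OF mem[OF that] z] by (intro differentiable_mult) auto
  have "L (u \<eta>) z = L (\<lambda>y. \<Sum>\<delta>=1..\<eta>. b \<delta> * \<Psi> \<delta> y * u (\<eta> - \<delta>) y) z"
    unfolding L_def by (rule lin_op_cong_open[OF S z Psi_\<eta>]) (use d in \<open>auto intro: differentiable_sum\<close>)
  also have "\<dots> = (\<Sum>\<delta>=1..\<eta>. L (\<lambda>y. b \<delta> * \<Psi> \<delta> y * u (\<eta> - \<delta>) y) z)"
    unfolding L_def by (rule lin_op_sum) (use d in auto)
  also have "\<dots> = (\<Sum>\<delta>=1..\<eta>. b \<delta> * L (\<Psi> \<delta>) z * u (\<eta> - \<delta>) z + x * (b \<delta> * \<Psi> \<delta> z * u (\<eta> - \<delta>) z)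
      + b \<delta> * of_nat (\<eta> - \<delta>) * \<Psi> \<delta> z * u (\<eta> - \<delta> - 1) z)"
  proof (rule sum.cong)
    fix \<delta> assume \<delta>: "\<delta> \<in> {1..\<eta>}"
    have "L (u (\<eta> - \<delta>)) z = x * u (\<eta> - \<delta>) z + of_nat (\<eta> - \<delta>) * u (\<eta> - \<delta> - 1) z"
      unfolding L_def using Lu[OF _ z, of "\<eta> - \<delta>"] less.prems by auto
    moreover have "L (\<lambda>y. b \<delta> * \<Psi> \<delta> y * u (\<eta> - \<delta>) y) z =
        b \<delta> * L (\<Psi> \<delta>) z * u (\<eta> - \<delta>) z + b \<delta> * \<Psi> \<delta> z * L (u (\<eta> - \<delta>)) z"
      unfolding L_def using du[OF z] dPsi[OF mem[OF \<delta>] z]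
      by (simp add: lin_op_mult lin_op_cmult differentiable_mult)
    ultimately show "L (\<lambda>y. b \<delta> * \<Psi> \<delta> y * u (\<eta> - \<delta>) y) z =
        b \<delta> * L (\<Psi> \<delta>) z * u (\<eta> - \<delta>) z + x * (b \<delta> * \<Psi> \<delta> z * u (\<eta> - \<delta>) z)
        + b \<delta> * of_nat (\<eta> - \<delta>) * \<Psi> \<delta> z * u (\<eta> - \<delta> - 1) z"
      by (simp add: algebra_simps)
  qed simp
  also have "\<dots> = (\<Sum>\<delta>=1..\<eta>. b \<delta> * L (\<Psi> \<delta>) z * u (\<eta> - \<delta>) z) + x * u \<eta> z
      + (\<Sum>\<delta>=1..\<eta>. b \<delta> * of_nat (\<eta> - \<delta>) * \<Psi> \<delta> z * u (\<eta> - \<delta> - 1) z)"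
    by (simp add: sum.distrib Psi_\<eta>[OF z] sum_distrib_left)
  also have "(\<Sum>\<delta>=1..\<eta>. b \<delta> * of_nat (\<eta> - \<delta>) * \<Psi> \<delta> z * u (\<eta> - \<delta> - 1) z) = of_nat n * u n z"
  proof (cases "n = 0")
    case True
    then show ?thesis by (simp add: n)
  next
    case False
    have "(\<Sum>\<delta>=1..\<eta>. b \<delta> * of_nat (\<eta> - \<delta>) * \<Psi> \<delta> z * u (\<eta> - \<delta> - 1) z)
        = (\<Sum>\<delta>=1..n. b \<delta> * of_nat (\<eta> - \<delta>) * \<Psi> \<delta> z * u (\<eta> - \<delta> - 1) z)"
      by (simp add: n)
    also have "\<dots> = (\<Sum>\<delta>=1..n. of_nat n * (of_nat ((n - 1) choose (\<delta> - 1)) * \<Psi> \<delta> z * u (n - \<delta>) z))"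
    proof (rule sum.cong)
      fix \<delta> assume \<delta>: "\<delta> \<in> {1..n}"
      have "(n - (\<delta> - 1)) * (n choose (\<delta> - 1)) = n * ((n - 1) choose (\<delta> - 1))"
        by (rule binomial_absorb_comp)
      moreover have "n - (\<delta> - 1) = \<eta> - \<delta>" using \<delta> n by auto
      ultimately have "b \<delta> * of_nat (\<eta> - \<delta>) = of_nat n * of_nat ((n - 1) choose (\<delta> - 1))"
        unfolding b_def of_nat_mult[symmetric] by (simp add: mult.commute)
      then show "b \<delta> * of_nat (\<eta> - \<delta>) * \<Psi> \<delta> z * u (\<eta> - \<delta> - 1) z =
          of_nat n * (of_nat ((n - 1) choose (\<delta> - 1)) * \<Psi> \<delta> z * u (n - \<delta>) z)"
        by (simp add: n)
    qed simp
    also have "\<dots> = of_nat n * u n z"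
      using Psi[OF _ z, of n] less.prems False n by (simp add: sum_distrib_left)
    finally show ?thesis .
  qed
  finally have eq: "(\<Sum>\<delta>=1..\<eta>. b \<delta> * L (\<Psi> \<delta>) z * u (\<eta> - \<delta>) z) = u n z"
    using Lu[OF _ z, of \<eta>] less.prems unfolding L_def by (simp add: n algebra_simps)
  have "(\<Sum>\<delta>=1..n. b \<delta> * L (\<Psi> \<delta>) z * u (\<eta> - \<delta>) z) = (\<Sum>\<delta>=1..n. if \<delta> = 1 then u n z else 0)"
    by (rule sum.cong) (use less n in \<open>auto simp: L_def b_def\<close>)
  also have "\<dots> = (if n = 0 then 0 else u n z)" by auto
  finally have "L (\<Psi> \<eta>) z * u 0 z = (if n = 0 then u n z else 0)"
    using eq by (simp add: n b_def split: if_splits)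
  then show ?case
    using nz[OF z] by (auto simp: n L_def split: if_splits)
qed

section \<open>Eigenfunctions\<close>

lemma differentiable_prod:
  fixes f :: "'i \<Rightarrow> 'a::real_normed_vector \<Rightarrow> complex"
  assumes "finite I" "\<And>i. i \<in> I \<Longrightarrow> f i differentiable (at z)"
  shows "(\<lambda>z. \<Prod>i\<in>I. f i z) differentiable (at z)"
  using assms by (induction I) (simp_all add: differentiable_mult)

lemma lin_op_prod_eigen:
  assumes "finite I" "\<And>i. i \<in> I \<Longrightarrow> f i differentiable (at z)"
    and "\<And>i. i \<in> I \<Longrightarrow> lin_op c (f i) z = \<kappa> i * f i z"
  shows "lin_op c (\<lambda>z. \<Prod>i\<in>I. f i z) z = (\<Sum>i\<in>I. \<kappa> i) * (\<Prod>i\<in>I. f i z)"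
  using assms
proof (induction I)
  case (insert i I)
  then have i: "f i differentiable (at z)" "lin_op c (f i) z = \<kappa> i * f i z"
    and dI: "(\<lambda>z. \<Prod>i\<in>I. f i z) differentiable (at z)"
    and LI: "lin_op c (\<lambda>z. \<Prod>i\<in>I. f i z) z = (\<Sum>i\<in>I. \<kappa> i) * (\<Prod>i\<in>I. f i z)"
    by (blast intro: differentiable_prod)+
  show ?case
    unfolding prod.insert[OF insert.hyps] sum.insert[OF insert.hyps] lin_op_mult[OF i(1) dI] i(2) LI
    by (simp add: algebra_simps)
qed simp

lemma power_branch_of_nat:
  assumes "power_branch \<Omega> u (of_nat k) p" "z \<in> \<Omega>"
  shows "p z = u z ^ k"
  using assms by (auto simp: power_branch_def power_values_def exp_of_nat_mult)

text \<open>
  The quotient of the branch and of the branch built from the principal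
  logarithm of u y / u z takes its values among the numbers \<open>exp (c * (t + 2 * pi * \<i> * n))\<close>
  with integral n, where t is a logarithm of u z. Their set need not be discrete: for an irrational
  real exponent it is dense in a circle. But it is countable, so the quotient, which is continuous, is
  constant on a ball.
\<close>

lemma power_branch_local:
  fixes u :: "'a::real_normed_vector \<Rightarrow> complex"
  assumes \<Omega>: "open \<Omega>" and p: "power_branch \<Omega> u c p" and u: "continuous_on \<Omega> u"
    and c: "c \<notin> \<nat>" and z: "z \<in> \<Omega>"
  obtains S where "open S" "z \<in> S" "u z \<noteq> 0" "\<And>y. y \<in> S \<Longrightarrow> p y = p z * exp (c * Ln (u y / u z))"
proof -
  have val: "\<exists>t. p y = exp (c * t) \<and> exp t = u y" if "y \<in> \<Omega>" for y
    using p c that by (auto simp: power_branch_def power_values_def)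
  then have nz: "u y \<noteq> 0" if "y \<in> \<Omega>" for y using that by (metis exp_not_eq_zero)
  have uz: "u z \<noteq> 0" using nz z by blast
  have cu: "continuous_on \<Omega> (\<lambda>y. u y / u z)"
    using u uz by (intro continuous_intros) auto
  \<comment> \<open>The disc of radius 1 about 1 lies in the right half-plane, where the principal logarithm is continuous.\<close>
  have "open (\<Omega> \<inter> (\<lambda>y. u y / u z) -` ball 1 1)"
    by (rule continuous_open_preimage[OF cu \<Omega>]) simp
  moreover have "z \<in> \<Omega> \<inter> (\<lambda>y. u y / u z) -` ball 1 1" using z uz by simp
  ultimately obtain e where e: "e > 0" "ball z e \<subseteq> \<Omega> \<inter> (\<lambda>y. u y / u z) -` ball 1 1"
    using open_contains_ball by blast
  obtain t0 where t0: "exp t0 = u z" using val[OF z] by blast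
  define q where "q y = p y * exp (- (c * Ln (u y / u z)))" for y
  have nonpos: "u y / u z \<notin> \<real>\<^sub>\<le>\<^sub>0" if "y \<in> ball z e" for y
  proof
    assume "u y / u z \<in> \<real>\<^sub>\<le>\<^sub>0"
    then have "Re (u y / u z) \<le> 0" by (simp add: complex_nonpos_Reals_iff)
    moreover have "\<bar>Re (1 - u y / u z)\<bar> < 1"
      using e(2) that abs_Re_le_cmod[of "1 - u y / u z"] by (auto simp: dist_norm)
    ultimately show False by simp
  qed
  have "continuous_on (ball z e) q"
    unfolding q_def using p e(2) nonpos
    by (intro continuous_intros continuous_on_subset[OF cu])
      (auto simp: power_branch_def intro: continuous_on_subset)
  then have conn: "connected (q ` ball z e)"
    by (rule connected_continuous_image) simp
  have "q ` ball z e \<subseteq> range (\<lambda>n::int. exp (c * (t0 + of_int (2 * n) * pi * \<i>)))"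
  proof
    fix v assume "v \<in> q ` ball z e"
    then obtain y where y: "y \<in> ball z e" "v = q y" by blast
    then have y\<Omega>: "y \<in> \<Omega>" using e(2) by blast
    obtain t where t: "p y = exp (c * t)" "exp t = u y" using val[OF y\<Omega>] by blast
    have "exp (t - Ln (u y / u z)) = exp t0"
      using t(2) t0 nz[OF y\<Omega>] uz by (simp add: exp_diff)
    then obtain n :: int where "t - Ln (u y / u z) = t0 + of_int (2 * n) * pi * \<i>"
      unfolding exp_eq by blast
    moreover have "q y = exp (c * (t - Ln (u y / u z)))"
      by (simp add: q_def t(1) right_diff_distrib exp_diff exp_minus divide_inverse)
    ultimately have "q y = exp (c * (t0 + of_int (2 * n) * pi * \<i>))" by simp
    then show "v \<in> range (\<lambda>n::int. exp (c * (t0 + of_int (2 * n) * pi * \<i>)))"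
      using y(2) by blast
  qed
  then have "countable (q ` ball z e)"
    by (rule countable_subset) simp
  then have const: "q y = q z" if "y \<in> ball z e" for y
    using connected_uncountable[OF conn, of "q y" "q z"] that e(1) by force
  have qz: "q z = p z" using uz by (simp add: q_def)
  have loc: "p y = p z * exp (c * Ln (u y / u z))" if "y \<in> ball z e" for y
  proof -
    have "q y * exp (c * Ln (u y / u z)) = p y"
      unfolding q_def mult.assoc exp_add[symmetric] by simp
    then show ?thesis using const[OF that] qz by simp
  qed
  show ?thesis by (rule that[OF open_ball _ uz loc]) (use e(1) in auto)
qed

text \<open>
  For a natural exponent the branch is an ordinary power and u may vanish; in all other cases
  the branch is locally an exponential of the logarithm of u, and u does not vanish.
\<close>

lemma
  fixes u :: "complex ^ 'n::finite \<Rightarrow> complex"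
  assumes \<Omega>: "open \<Omega>" and p: "power_branch \<Omega> u \<alpha> p"
    and u: "\<And>z. z \<in> \<Omega> \<Longrightarrow> u differentiable (at z)" and z: "z \<in> \<Omega>"
  shows differentiable_power_branch: "p differentiable (at z)"
    and lin_op_power_branch: "lin_op c u z = x * u z \<Longrightarrow> lin_op c p z = (x * \<alpha>) * p z"
proof -
  have "p differentiable (at z) \<and> (\<forall>x. lin_op c u z = x * u z \<longrightarrow> lin_op c p z = (x * \<alpha>) * p z)"
  proof (cases "\<alpha> \<in> \<nat>")
    case True
    then obtain k where k: "\<alpha> = of_nat k" by (auto elim: Nats_cases)
    have eq: "p y = u y ^ k" if "y \<in> \<Omega>" for y
      using power_branch_of_nat[OF p[unfolded k] that] .
    have der: "((\<lambda>w. w ^ k) has_field_derivative of_nat k * u z ^ (k - 1)) (at (u z))"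
      by (auto intro!: derivative_eq_intros)
    note dp = differentiable_chain[OF u[OF z] der]
    have "u z * u z ^ (k - 1) = u z ^ k" if "k > 0"
      using that by (cases k) auto
    then have *: "of_nat k * u z ^ (k - 1) * (x * u z) = x * \<alpha> * p z" for x
      unfolding eq[OF z] k by (cases "k = 0") (auto simp: algebra_simps)
    have "lin_op c p z = lin_op c (\<lambda>y. u y ^ k) z"
      by (rule lin_op_cong_open[OF \<Omega> z eq dp])
    also have "\<dots> = of_nat k * u z ^ (k - 1) * lin_op c u z"
      by (rule lin_op_chain[OF u[OF z] der])
    finally have "lin_op c p z = x * \<alpha> * p z" if "lin_op c u z = x * u z" for x
      unfolding that * .
    then show ?thesis
      using differentiable_cong_open[OF \<Omega> z eq dp] by blast
  next
    case False
    have "continuous_on \<Omega> u"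
      using u by (meson continuous_at_imp_continuous_on differentiable_imp_continuous_within)
    from power_branch_local[OF \<Omega> p this False z]
    obtain S where S: "open S" "z \<in> S" and uz: "u z \<noteq> 0"
      and eq: "\<And>y. y \<in> S \<Longrightarrow> p y = p z * exp (\<alpha> * Ln (u y / u z))" by blast
    have der: "((\<lambda>w. p z * exp (\<alpha> * Ln (w / u z))) has_field_derivative p z * \<alpha> / u z) (at (u z))"
      using uz by (auto intro!: derivative_eq_intros)
    note dp = differentiable_chain[OF u[OF z] der]
    have "lin_op c p z = lin_op c (\<lambda>y. p z * exp (\<alpha> * Ln (u y / u z))) z"
      by (rule lin_op_cong_open[OF S eq dp])
    also have "\<dots> = p z * \<alpha> / u z * lin_op c u z"
      by (rule lin_op_chain[OF u[OF z] der])
    finally have "lin_op c p z = x * \<alpha> * p z" if "lin_op c u z = x * u z" for x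
      unfolding that using uz by (simp add: field_simps)
    then show ?thesis
      using differentiable_cong_open[OF S eq dp] by blast
  qed
  then show "p differentiable (at z)"
    and "lin_op c u z = x * u z \<Longrightarrow> lin_op c p z = (x * \<alpha>) * p z" by blast+
qed

section \<open>The exponents\<close>

text \<open>
  Gaussian elimination: an unknown that occurs in the first equation is eliminated from the
  others, which costs one equation and one unknown. Indexing by arbitrary finite sets lets the
  unknowns be pairs later.
\<close>

lemma underdetermined_system_has_nontrivial_solution:
  fixes A :: "'i \<Rightarrow> 'k \<Rightarrow> 'a::field"
  assumes "finite I" "finite J" "card I < card J"
  shows "\<exists>x. (\<exists>k\<in>J. x k \<noteq> 0) \<and> (\<forall>i\<in>I. (\<Sum>k\<in>J. A i k * x k) = 0)"
  using assms
proof (induction I arbitrary: J A)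
  case empty
  then have "J \<noteq> {}" by auto
  then show ?case by (intro exI[of _ "\<lambda>_. 1"]) auto
next
  case (insert i I)
  show ?case
  proof (cases "\<forall>k\<in>J. A i k = 0")
    case True
    then show ?thesis using insert.IH[of J A] insert.prems insert.hyps by auto
  next
    case False
    then obtain k0 where k0: "k0 \<in> J" "A i k0 \<noteq> 0" by blast
    define J' where "J' = J - {k0}"
    have J': "finite J'" "k0 \<notin> J'" "J = insert k0 J'" using insert.prems k0 by (auto simp: J'_def)
    have "card I < card J'" using insert.prems insert.hyps J' by simp
    from insert.IH[OF J'(1) this, of "\<lambda>i' k. A i' k - A i' k0 * A i k / A i k0"]
    obtain x where x: "\<exists>k\<in>J'. x k \<noteq> 0"
      "\<And>i'. i' \<in> I \<Longrightarrow> (\<Sum>k\<in>J'. (A i' k - A i' k0 * A i k / A i k0) * x k) = 0" by blast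
    define y where "y = x(k0 := - (\<Sum>k\<in>J'. A i k * x k) / A i k0)"
    have sum_y: "(\<Sum>k\<in>J. A i' k * y k) = A i' k0 * y k0 + (\<Sum>k\<in>J'. A i' k * x k)" for i'
    proof -
      have "(\<Sum>k\<in>J'. A i' k * y k) = (\<Sum>k\<in>J'. A i' k * x k)"
        by (rule sum.cong) (use J'(2) in \<open>auto simp: y_def\<close>)
      then show ?thesis unfolding J'(3) using J'(1,2) by simp
    qed
    have "(\<Sum>k\<in>J. A i k * y k) = 0"
      unfolding sum_y using k0(2) by (simp add: y_def)
    moreover have "(\<Sum>k\<in>J. A i' k * y k) = 0" if "i' \<in> I" for i'
    proof -
      have "(\<Sum>k\<in>J. A i' k * y k) = (\<Sum>k\<in>J'. (A i' k - A i' k0 * A i k / A i k0) * x k)"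
        unfolding sum_y
        by (simp add: y_def left_diff_distrib sum_subtractf sum_distrib_left sum_divide_distrib mult.assoc)
      then show ?thesis using x(2)[OF that] by simp
    qed
    moreover have "\<exists>k\<in>J. y k \<noteq> 0" using x(1) J' by (auto simp: y_def)
    ultimately show ?thesis by blast
  qed
qed

text \<open>
  A block l contributes between 1 and \<^term>\<open>s l\<close> unknowns, and m + 1 unknowns are wanted. The
  blocks are used up in order; the last one needed is cut so that the total is exact.
\<close>

lemma admissible_exists:
  assumes s: "\<And>l. l \<in> {1..r} \<Longrightarrow> s l \<ge> 1" and sum: "(\<Sum>l=1..r. s l) \<ge> m + 1"
  shows "\<exists>\<alpha> \<epsilon>. admissible m r s \<alpha> \<epsilon>"
proof -
  define \<alpha> where "\<alpha> = (LEAST \<alpha>. (\<Sum>l=1..\<alpha>. s l) \<ge> m + 1)"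
  have ge: "(\<Sum>l=1..\<alpha>. s l) \<ge> m + 1" unfolding \<alpha>_def by (rule LeastI[of _ r]) (rule sum)
  have "\<alpha> \<le> r" unfolding \<alpha>_def by (rule Least_le) (rule sum)
  obtain \<beta> where \<beta>: "\<alpha> = Suc \<beta>" using ge by (cases \<alpha>) auto
  have le: "(\<Sum>l=1..\<beta>. s l) \<le> m"
    using not_less_Least[of \<beta> "\<lambda>\<alpha>. (\<Sum>l=1..\<alpha>. s l) \<ge> m + 1"] \<beta> unfolding \<alpha>_def by auto
  define \<epsilon> where "\<epsilon> l = (if l \<le> \<beta> then s l - 1 else m - (\<Sum>l=1..\<beta>. s l))" for l
  have "(\<Sum>l=1..\<beta>. int (\<epsilon> l)) = (\<Sum>l=1..\<beta>. int (s l) - 1)"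
    by (rule sum.cong) (use s \<open>\<alpha> \<le> r\<close> \<beta> in \<open>auto simp: \<epsilon>_def of_nat_diff\<close>)
  then have "(\<Sum>l=1..\<alpha>. int (\<epsilon> l)) = int m - int \<alpha> + 1"
    using le by (simp add: \<beta> \<epsilon>_def of_nat_diff sum_subtractf)
  moreover have "\<epsilon> l \<le> s l - 1" if "l \<in> {1..\<alpha>}" for l
    using that ge \<beta> by (auto simp: \<epsilon>_def le_Suc_eq)
  ultimately show ?thesis using \<open>\<alpha> \<le> r\<close> unfolding admissible_def by blast
qed

text \<open>
  There are \<^term>\<open>\<epsilon> \<xi> + 1\<close> unknowns for each \<xi>, hence m + 1 unknowns for m equations.
\<close>

lemma nontrivial_solution_exists:
  assumes "admissible m r s \<alpha> \<epsilon>"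
  shows "\<exists>h. nontrivial_solution m lam \<mu> \<alpha> \<epsilon> h"
proof -
  let ?J = "SIGMA \<xi>:{1..\<alpha>}. {0..\<epsilon> \<xi>}"
  define A where "A j = (\<lambda>(\<xi>, q). if q = 0 then lam j \<xi> else \<mu> j q \<xi>)" for j
  have "int (card ?J) = (\<Sum>\<xi>=1..\<alpha>. int (\<epsilon> \<xi>) + 1)"
    by (simp add: card_SigmaI add.commute)
  also have "\<dots> = int m + 1"
    using assms by (simp add: admissible_def sum.distrib)
  finally have "card {1..m} < card ?J" unfolding card_atLeastAtMost by linarith
  from underdetermined_system_has_nontrivial_solution[OF _ _ this, of A]
  obtain x where x: "\<exists>k\<in>?J. x k \<noteq> 0" "\<forall>j\<in>{1..m}. (\<Sum>k\<in>?J. A j k * x k) = 0" by auto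
  define h where "h q \<xi> = x (\<xi>, q)" for q \<xi>
  have "(\<Sum>\<xi>=1..\<alpha>. lam j \<xi> * h 0 \<xi> + (\<Sum>q=1..\<epsilon> \<xi>. \<mu> j q \<xi> * h q \<xi>)) = (\<Sum>k\<in>?J. A j k * x k)" for j
  proof -
    have "(\<Sum>k\<in>?J. A j k * x k) = (\<Sum>\<xi>=1..\<alpha>. \<Sum>q=0..\<epsilon> \<xi>. A j (\<xi>, q) * x (\<xi>, q))"
      by (subst sum.Sigma) auto
    also have "\<dots> = (\<Sum>\<xi>=1..\<alpha>. lam j \<xi> * h 0 \<xi> + (\<Sum>q=1..\<epsilon> \<xi>. \<mu> j q \<xi> * h q \<xi>))"
      by (rule sum.cong) (auto simp: sum.atLeast_Suc_atMost[of 0] A_def h_def)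
    finally show ?thesis ..
  qed
  then have "nontrivial_solution m lam \<mu> \<alpha> \<epsilon> h"
    using x by (auto simp: nontrivial_solution_def h_def)
  then show ?thesis by blast
qed

section \<open>First integrals of the system\<close>

theorem theorem2p11:
  fixes a :: "nat \<Rightarrow> 'n::finite + 'n \<Rightarrow> 'n + 'n \<Rightarrow> complex"
    and m \<zeta> r :: nat
    and s :: "nat \<Rightarrow> nat"
    and lam :: "nat \<Rightarrow> nat \<Rightarrow> complex"
    and \<nu> :: "nat \<Rightarrow> nat \<Rightarrow> complex ^ ('n + 'n)"
    and \<Psi> :: "nat \<Rightarrow> nat \<Rightarrow> complex ^ 'n \<Rightarrow> complex"
    and G :: "nat \<Rightarrow> (complex ^ 'n) set"
  assumes jac: "jacobian_system m a"
    and zeta: "\<zeta> \<in> {1..m}"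
    and smallest: "\<And>j. j \<in> {1..m} \<Longrightarrow>
      size (elementary_divisors (op_matrix (a \<zeta>))) \<le> size (elementary_divisors (op_matrix (a j)))"
    and s_ge: "\<And>l. l \<in> {1..r} \<Longrightarrow> s l \<ge> 2"
    and s_sum: "(\<Sum>l=1..r. s l) \<ge> m + 1"
    and eldiv: "\<And>l. l \<in> {1..r} \<Longrightarrow>
      [:- lam \<zeta> l, 1:] ^ s l \<in># elementary_divisors (op_matrix (a \<zeta>))"
    and eigvec_nz: "\<And>l. l \<in> {1..r} \<Longrightarrow> \<nu> 0 l \<noteq> 0"
    and eigvec: "\<And>j l. j \<in> {1..m} \<Longrightarrow> l \<in> {1..r} \<Longrightarrow>
      op_matrix (a j) *v \<nu> 0 l = lam j l *s \<nu> 0 l"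
    and geigvec_nz: "\<And>\<eta> l. l \<in> {1..r} \<Longrightarrow> \<eta> \<in> {1..s l - 1} \<Longrightarrow> \<nu> \<eta> l \<noteq> 0"
    and geigvec: "\<And>\<eta> l. l \<in> {1..r} \<Longrightarrow> \<eta> \<in> {1..s l - 1} \<Longrightarrow>
      (op_matrix (a \<zeta>) - mat (lam \<zeta> l)) *v \<nu> \<eta> l = of_nat \<eta> *s \<nu> (\<eta> - 1) l"
    and dom: "\<And>l. l \<in> {1..r} \<Longrightarrow> is_domain (G l) \<and> G l \<subseteq> {z. linear_form (\<nu> 0 l) z \<noteq> 0}"
    and Psi: "\<And>\<eta> l z. l \<in> {1..r} \<Longrightarrow> \<eta> \<in> {1..s l - 1} \<Longrightarrow> z \<in> G l \<Longrightarrow>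
      linear_form (\<nu> \<eta> l) z =
        (\<Sum>\<delta>=1..\<eta>. of_nat ((\<eta> - 1) choose (\<delta> - 1)) * \<Psi> \<delta> l z * linear_form (\<nu> (\<eta> - \<delta>) l) z)"
    and no_fi: "\<And>j \<eta> l. j \<in> {1..m} \<Longrightarrow> j \<noteq> \<zeta> \<Longrightarrow> l \<in> {1..r} \<Longrightarrow> \<eta> \<in> {1..s l - 1} \<Longrightarrow>
      \<not> (first_integral {a \<zeta>} (G l) (lin_op (a j) (\<Psi> \<eta> l)) \<and>
          \<not> lin_op (a j) (\<Psi> \<eta> l) constant_on G l)"
  shows "\<exists>\<mu> :: nat \<Rightarrow> nat \<Rightarrow> nat \<Rightarrow> complex.
      (\<forall>j\<in>{1..m}. \<forall>l\<in>{1..r}. \<forall>\<eta>\<in>{1..s l - 1}. \<forall>z\<in>G l. lin_op (a j) (\<Psi> \<eta> l) z = \<mu> j \<eta> l) \<and>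
      (\<exists>\<alpha> \<epsilon>. admissible m r s \<alpha> \<epsilon>) \<and>
      (\<forall>\<alpha> \<epsilon>. admissible m r s \<alpha> \<epsilon> \<longrightarrow>
         (\<exists>h. nontrivial_solution m lam \<mu> \<alpha> \<epsilon> h) \<and>
         (\<forall>h \<Omega> p.
            nontrivial_solution m lam \<mu> \<alpha> \<epsilon> h \<and> is_domain \<Omega> \<and>
            (\<forall>\<xi>\<in>{1..\<alpha>}. power_branch \<Omega> (linear_form (\<nu> 0 \<xi>)) (h 0 \<xi>) (p \<xi>) \<and>
                         (\<epsilon> \<xi> \<ge> 1 \<longrightarrow> \<Omega> \<subseteq> G \<xi>)) \<longrightarrow>
            first_integral (a ` {1..m}) \<Omega>
              (\<lambda>z. \<Prod>\<xi>=1..\<alpha>. p \<xi> z * exp (\<Sum>q=1..\<epsilon> \<xi>. h q \<xi> * \<Psi> q \<xi> z))))"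
proof -
  define u where "u l \<eta> = linear_form (\<nu> \<eta> l)" for l \<eta>
  have open_G: "open (G l)" and u_nz: "z \<in> G l \<Longrightarrow> u l 0 z \<noteq> 0" if "l \<in> {1..r}" for l z
    using dom[OF that] by (auto simp: is_domain_def u_def)
  have lin_op_u0: "lin_op (a j) (u l 0) z = lam j l * u l 0 z" if "j \<in> {1..m}" "l \<in> {1..r}" for j l z
    using eigvec[OF that] by (simp add: u_def lin_op_linear_form linear_form_scale)
  have lin_op_u: "lin_op (a \<zeta>) (u l \<eta>) z = lam \<zeta> l * u l \<eta> z + of_nat \<eta> * u l (\<eta> - 1) z"
    if l: "l \<in> {1..r}" and "\<eta> \<le> s l - 1" for l \<eta> z
  proof (cases "\<eta> = 0")
    case True
    then show ?thesis using lin_op_u0[OF zeta l] by simp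
  next
    case False
    then have "(op_matrix (a \<zeta>) - mat (lam \<zeta> l)) *v \<nu> \<eta> l = of_nat \<eta> *s \<nu> (\<eta> - 1) l"
      using geigvec[OF l] that by simp
    then have "op_matrix (a \<zeta>) *v \<nu> \<eta> l = lam \<zeta> l *s \<nu> \<eta> l + of_nat \<eta> *s \<nu> (\<eta> - 1) l"
      by (simp add: matrix_vector_mult_diff_rdistrib mat_mult_vector algebra_simps)
    then show ?thesis
      by (simp add: u_def lin_op_linear_form linear_form_add linear_form_scale)
  qed
  have Psi_u: "u l \<eta> z = (\<Sum>\<delta>=1..\<eta>. of_nat ((\<eta> - 1) choose (\<delta> - 1)) * \<Psi> \<delta> l z * u l (\<eta> - \<delta>) z)"
    if "l \<in> {1..r}" "\<eta> \<in> {1..s l - 1}" "z \<in> G l" for l \<eta> z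
    using Psi[OF that] by (simp add: u_def)
  have comm: "commuting_on (a i) (a j) (G l) (\<Psi> \<eta> l)"
    if "i \<in> {1..m}" "j \<in> {1..m}" and l: "l \<in> {1..r}" and \<eta>: "\<eta> \<in> {1..s l - 1}" for i j l \<eta>
  proof (rule commuting_on_Psi[where \<Psi> = "\<lambda>\<eta>. \<Psi> \<eta> l" and u = "u l" and N = "s l - 1"])
    show "commuting_on (a i) (a j) (G l) (\<lambda>z. inverse (u l 0 z))"
      unfolding u_def using u_nz[OF l, unfolded u_def]
      by (intro commuting_on_inverse_eigenform[OF open_G[OF l] _ eigvec eigvec]) (use that in auto)
    show "commuting_on (a i) (a j) (G l) (u l \<eta>)" for \<eta>
      unfolding u_def by (rule commuting_on_linear_form[OF jac]) (use that in auto)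
  qed (use l \<eta> open_G u_nz Psi_u in auto)
  have diff_Psi: "\<Psi> \<eta> l differentiable (at z)"
    if "l \<in> {1..r}" "\<eta> \<in> {1..s l - 1}" "z \<in> G l" for l \<eta> z
    using comm[OF zeta zeta that(1,2)] that(3) by (simp add: commuting_on_def)
  have zeta_Psi: "lin_op (a \<zeta>) (\<Psi> \<eta> l) z = (if \<eta> = 1 then 1 else 0)"
    if l: "l \<in> {1..r}" and \<eta>: "\<eta> \<in> {1..s l - 1}" and "z \<in> G l" for l \<eta> z
    by (rule lin_op_Psi[where \<Psi> = "\<lambda>\<eta>. \<Psi> \<eta> l" and u = "u l" and S = "G l" and N = "s l - 1"
          and x = "lam \<zeta> l"])
      (use that open_G u_nz diff_Psi lin_op_u Psi_u in
        \<open>auto simp: u_def linear_form_differentiable\<close>)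

  have const: "lin_op (a j) (\<Psi> \<eta> l) y = lin_op (a j) (\<Psi> \<eta> l) z"
    if j: "j \<in> {1..m}" and l: "l \<in> {1..r}" and \<eta>: "\<eta> \<in> {1..s l - 1}"
      and yz: "y \<in> G l" "z \<in> G l" for j l \<eta> y z
  proof (cases "j = \<zeta>")
    case True
    then show ?thesis using zeta_Psi[OF l \<eta>] yz by simp
  next
    case False
    \<comment> \<open>Interchanging the operators brings the constant function of \<open>zeta_Psi\<close> inside.\<close>
    have "lin_op (a \<zeta>) (lin_op (a j) (\<Psi> \<eta> l)) x = 0" if x: "x \<in> G l" for x
    proof -
      have "lin_op (a \<zeta>) (lin_op (a j) (\<Psi> \<eta> l)) x = lin_op (a j) (lin_op (a \<zeta>) (\<Psi> \<eta> l)) x"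
        using comm[OF zeta j l \<eta>] x by (simp add: commuting_on_def)
      also have "\<dots> = lin_op (a j) (\<lambda>_. if \<eta> = 1 then 1 else 0) x"
        by (rule lin_op_cong_open[OF open_G[OF l] x zeta_Psi[OF l \<eta>]]) auto
      finally show ?thesis by simp
    qed
    moreover have "lin_op (a j) (\<Psi> \<eta> l) differentiable_on G l"
      using comm[OF zeta j l \<eta>]
      by (auto simp: commuting_on_def differentiable_on_def intro: differentiable_at_withinI)
    ultimately have "first_integral {a \<zeta>} (G l) (lin_op (a j) (\<Psi> \<eta> l))"
      by (simp add: first_integral_def)
    then have "lin_op (a j) (\<Psi> \<eta> l) constant_on G l"
      using no_fi[OF j False l \<eta>] by blast
    then show ?thesis using yz by (auto simp: constant_on_def)
  qed

  \<comment> \<open>Each \<^term>\<open>G l\<close> is nonempty, so the constants may be read off at any of its points.\<close>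
  define \<mu> where "\<mu> j \<eta> l = lin_op (a j) (\<Psi> \<eta> l) (SOME z. z \<in> G l)" for j \<eta> l
  have lin_op_Psi_\<mu>: "lin_op (a j) (\<Psi> \<eta> l) z = \<mu> j \<eta> l"
    if "j \<in> {1..m}" "l \<in> {1..r}" "\<eta> \<in> {1..s l - 1}" "z \<in> G l" for j \<eta> l z
    unfolding \<mu>_def by (rule const) (use that someI[of "\<lambda>z. z \<in> G l"] in auto)

  \<comment> \<open>Every factor of the product is an eigenfunction of each operator; the eigenvalues add up to zero.\<close>
  have fi: "first_integral (a ` {1..m}) \<Omega>
      (\<lambda>z. \<Prod>\<xi>=1..\<alpha>. p \<xi> z * exp (\<Sum>q=1..\<epsilon> \<xi>. h q \<xi> * \<Psi> q \<xi> z))"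
    if adm: "admissible m r s \<alpha> \<epsilon>" and sol: "nontrivial_solution m lam \<mu> \<alpha> \<epsilon> h"
      and \<Omega>: "is_domain \<Omega>"
      and p: "\<forall>\<xi>\<in>{1..\<alpha>}. power_branch \<Omega> (linear_form (\<nu> 0 \<xi>)) (h 0 \<xi>) (p \<xi>) \<and>
                           (\<epsilon> \<xi> \<ge> 1 \<longrightarrow> \<Omega> \<subseteq> G \<xi>)"
    for \<alpha> \<epsilon> h \<Omega> p
  proof -
    let ?f = "\<lambda>\<xi> z. p \<xi> z * exp (\<Sum>q=1..\<epsilon> \<xi>. h q \<xi> * \<Psi> q \<xi> z)"
    have oO: "open \<Omega>" using \<Omega> by (simp add: is_domain_def)
    have factor: "?f \<xi> differentiable (at z) \<and> (\<forall>j\<in>{1..m}. lin_op (a j) (?f \<xi>) z =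
        (lam j \<xi> * h 0 \<xi> + (\<Sum>q=1..\<epsilon> \<xi>. \<mu> j q \<xi> * h q \<xi>)) * ?f \<xi> z)"
      if \<xi>: "\<xi> \<in> {1..\<alpha>}" and z: "z \<in> \<Omega>" for \<xi> z
    proof -
      have \<xi>r: "\<xi> \<in> {1..r}" and eps: "\<epsilon> \<xi> \<le> s \<xi> - 1"
        using adm \<xi> by (auto simp: admissible_def)
      have branch: "power_branch \<Omega> (u \<xi> 0) (h 0 \<xi>) (p \<xi>)" using p \<xi> by (simp add: u_def)
      have du: "u \<xi> 0 differentiable (at y)" for y
        by (simp add: u_def linear_form_differentiable)
      have dp: "p \<xi> differentiable (at z)"
        by (rule differentiable_power_branch[OF oO branch du z])
      have Lp: "lin_op (a j) (p \<xi>) z = lam j \<xi> * h 0 \<xi> * p \<xi> z" if "j \<in> {1..m}" for j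
        by (rule lin_op_power_branch[OF oO branch du z lin_op_u0[OF that \<xi>r]])
      have G: "\<Omega> \<subseteq> G \<xi>" if "\<epsilon> \<xi> \<ge> 1" using p \<xi> that by blast
      \<comment> \<open>For \<^term>\<open>\<epsilon> \<xi> = 0\<close> the range of q is empty, and nothing is known about \<Psi> at z.\<close>
      have q: "q \<in> {1..s \<xi> - 1} \<and> z \<in> G \<xi>" if "q \<in> {1..\<epsilon> \<xi>}" for q
        using that z eps G by auto
      let ?E = "\<lambda>z. \<Sum>q=1..\<epsilon> \<xi>. h q \<xi> * \<Psi> q \<xi> z"
      have dq: "(\<lambda>z. h q \<xi> * \<Psi> q \<xi> z) differentiable (at z)" if "q \<in> {1..\<epsilon> \<xi>}" for q
        using diff_Psi[OF \<xi>r] q[OF that] by (intro differentiable_mult) auto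
      have dE: "?E differentiable (at z)"
        using dq by (intro differentiable_sum) auto
      have LE: "lin_op (a j) ?E z = (\<Sum>q=1..\<epsilon> \<xi>. \<mu> j q \<xi> * h q \<xi>)" if j: "j \<in> {1..m}" for j
      proof -
        have "lin_op (a j) ?E z = (\<Sum>q=1..\<epsilon> \<xi>. lin_op (a j) (\<lambda>z. h q \<xi> * \<Psi> q \<xi> z) z)"
          by (rule lin_op_sum) (use dq in auto)
        also have "\<dots> = (\<Sum>q=1..\<epsilon> \<xi>. \<mu> j q \<xi> * h q \<xi>)"
        proof (rule sum.cong)
          fix q' assume "q' \<in> {1..\<epsilon> \<xi>}"
          with q have "q' \<in> {1..s \<xi> - 1}" "z \<in> G \<xi>" by blast+
          then show "lin_op (a j) (\<lambda>z. h q' \<xi> * \<Psi> q' \<xi> z) z = \<mu> j q' \<xi> * h q' \<xi>"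
            using diff_Psi[OF \<xi>r] lin_op_Psi_\<mu>[OF j \<xi>r] by (simp add: lin_op_cmult)
        qed simp
        finally show ?thesis .
      qed
      note dexp = differentiable_chain[OF dE DERIV_exp]
      show ?thesis
      proof (intro conjI ballI)
        show "?f \<xi> differentiable (at z)" by (intro differentiable_mult dp dexp)
        fix j assume j: "j \<in> {1..m}"
        show "lin_op (a j) (?f \<xi>) z =
            (lam j \<xi> * h 0 \<xi> + (\<Sum>q=1..\<epsilon> \<xi>. \<mu> j q \<xi> * h q \<xi>)) * ?f \<xi> z"
          unfolding lin_op_mult[OF dp dexp] lin_op_chain[OF dE DERIV_exp] Lp[OF j] LE[OF j]
          by (simp add: algebra_simps)
      qed
    qed
    show ?thesis
      unfolding first_integral_def differentiable_on_def
    proof (intro conjI ballI)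
      fix z assume z: "z \<in> \<Omega>"
      have "(\<lambda>z. \<Prod>\<xi>=1..\<alpha>. ?f \<xi> z) differentiable (at z)"
        by (rule differentiable_prod) (use factor[OF _ z] in auto)
      then show "(\<lambda>z. \<Prod>\<xi>=1..\<alpha>. ?f \<xi> z) differentiable (at z within \<Omega>)"
        by (rule differentiable_at_withinI)
    next
      fix c z assume "c \<in> a ` {1..m}" and z: "z \<in> \<Omega>"
      then obtain j where j: "j \<in> {1..m}" "c = a j" by blast
      have "lin_op (a j) (\<lambda>z. \<Prod>\<xi>=1..\<alpha>. ?f \<xi> z) z =
          (\<Sum>\<xi>=1..\<alpha>. lam j \<xi> * h 0 \<xi> + (\<Sum>q=1..\<epsilon> \<xi>. \<mu> j q \<xi> * h q \<xi>)) * (\<Prod>\<xi>=1..\<alpha>. ?f \<xi> z)"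
        by (rule lin_op_prod_eigen) (use factor[OF _ z] j(1) in blast)+
      also have "\<dots> = 0"
        using sol j(1) by (simp add: nontrivial_solution_def)
      finally show "lin_op c (\<lambda>z. \<Prod>\<xi>=1..\<alpha>. ?f \<xi> z) z = 0" using j(2) by simp
    qed
  qed

  have "\<exists>\<alpha> \<epsilon>. admissible m r s \<alpha> \<epsilon>"
    using admissible_exists[OF _ s_sum] s_ge by force
  then show ?thesis
    using lin_op_Psi_\<mu> nontrivial_solution_exists fi by (intro exI[of _ \<mu>]) blast
qed

end
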